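(* Fix two positive integers $e$ and $r$, and suppose that the set $\mathcal{C}$ of Gorenstein $h$-vectors of socle degree $e$ and codimension $r$ coincides with the set of SI-sequences of the form $(1,r,h_2,\dots,h_e)$. Then the Gorenstein Interval Conjecture (GIC), and therefore the Interval Conjecture (IC), holds for the class $\mathcal{C}$.
   Context: Let $k$ be a field of characteristic zero. All algebras are standard graded artinian algebras $A=R/I$, where $R=k[x_1,\dots,x_r]$, all $x_i$ have degree $1$, and $I$ is a homogeneous ideal of $R$ containing no nonzero forms of degree $1$. The $h$-vector of $A$ is $h(A)=(h_0,h_1,\dots,h_e)$, where $h_i=\dim_k A_i$ and $e$ is the last index with $\dim_k A_e>0$; thus $h_0=1$. The number $r=h_1$ is the codimension of $A$ (or of $h$), and $e$ is the socle degree. The socle of $A$ is the annihilator in $A$ of its homogeneous maximal ideal. $A$ is level of type $t$ if its socle is concentrated in degree $e$ and has dimension $t=h_e$; it is Gorenstein if it is level of type $1$. An $h$-vector is Gorenstein if it is the $h$-vector of some Gorenstein standard graded artinian algebra $A=k[x_1,\dots,x_r]/I$, where all $x_i$ have degree $1$ and $I$ is a homogeneous ideal containing no nonzero forms of degree $1$. Gorenstein $h$-vectors are symmetric. A vector $(h_0=1,h_1,\dots,h_e)$ is an SI-sequence if it is symmetric ($h_i=h_{e-i}$ for all $i$) and its first half is differentiable, i.e. the vector $(1,h_1-h_0,h_2-h_1,\dots,h_{\lfloor e/2\rfloor}-h_{\lfloor e/2\rfloor-1})$ is the $h$-vector of some artinian algebra or, equivalently, satisfies Macaulay's theorem on the growth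 of Hilbert functions (trailing zeros are allowed). The IC holds for a class $\mathcal{C}$ of $h$-vectors if: whenever, for some index $i$ and some positive integer $\alpha$, both $(1,h_1,\dots,h_i,\dots,h_e)$ and $(1,h_1,\dots,h_i+\alpha,\dots,h_e)$ (differing only in degree $i$) belong to $\mathcal{C}$, then $(1,h_1,\dots,h_i+\beta,\dots,h_e)$ belongs to $\mathcal{C}$ for every integer $\beta=0,1,\dots,\alpha$. The GIC holds for a class $\mathcal{C}$ of Gorenstein $h$-vectors if: whenever, for some index $i$ and some positive integer $\alpha$, both $(1,h_1,\dots,h_i,\dots,h_{e-i},\dots,h_{e-1},1)$ and $(1,h_1,\dots,h_i+\alpha,\dots,h_{e-i}+\alpha,\dots,h_{e-1},1)$ (differing only in degrees $i$ and $e-i$) belong to $\mathcal{C}$, then $(1,h_1,\dots,h_i+\beta,\dots,h_{e-i}+\beta,\dots,h_{e-1},1)$ belongs to $\mathcal{C}$ for every integer $\beta=0,1,\dots,\alpha$. When $i=e-i=e/2$, only the single middle entry is changed, by $\alpha$ (respectively $\beta$). *)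

theory Defs
  imports
    "HOL-Library.Poly_Mapping"
    "HOL-Algebra.QuotRing"
    "HOL-Algebra.Embedded_Algebras"
begin

section \<open>Standard graded artinian algebras\<close>

text \<open>
  A monomial is an exponent vector \<open>nat \<Rightarrow>\<^sub>0 nat\<close>. Arithmetic of polynomials is the
  convolution arithmetic of \<^theory>\<open>HOL-Library.Poly_Mapping\<close>, in countably many variables;
  \<open>poly_ring r\<close> is the subring \<open>k[x\<^sub>0,\<dots>,x\<^sub>r\<^sub>-\<^sub>1]\<close>.
\<close>

type_synonym 'k mpoly = "(nat \<Rightarrow>\<^sub>0 nat) \<Rightarrow>\<^sub>0 'k"

definition mon_degree :: "(nat \<Rightarrow>\<^sub>0 nat) \<Rightarrow> nat" where
  "mon_degree m = (\<Sum>v\<in>Poly_Mapping.keys m. Poly_Mapping.lookup m v)"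

definition poly_ring :: "nat \<Rightarrow> 'k::field_char_0 mpoly ring" where
  "poly_ring r =
     \<lparr>carrier = {p. \<forall>m\<in>Poly_Mapping.keys p. Poly_Mapping.keys m \<subseteq> {..<r}},
      mult = (*), one = 1, zero = 0, add = (+)\<rparr>"

definition forms :: "nat \<Rightarrow> nat \<Rightarrow> 'k::field_char_0 mpoly set" where
  "forms r d = {p \<in> carrier (poly_ring r). \<forall>m\<in>Poly_Mapping.keys p. mon_degree m = d}"

definition homogeneous_ideal :: "nat \<Rightarrow> 'k::field_char_0 mpoly set \<Rightarrow> bool" where
  "homogeneous_ideal r I \<longleftrightarrow> (\<exists>S \<subseteq> (\<Union>d. forms r d). I = Idl\<^bsub>poly_ring r\<^esub> S)"

abbreviation quot_alg :: "nat \<Rightarrow> 'k::field_char_0 mpoly set \<Rightarrow> 'k mpoly set ring" where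
  "quot_alg r I \<equiv> poly_ring r Quot I"

definition quot_part :: "nat \<Rightarrow> 'k::field_char_0 mpoly set \<Rightarrow> nat \<Rightarrow> 'k mpoly set set" where
  "quot_part r I d = (\<lambda>p. I +>\<^bsub>poly_ring r\<^esub> p) ` forms r d"

text \<open>
  The dimension of a subspace \<open>E\<close> of \<open>A = R/I\<close> over the copy of \<open>k\<close> in \<open>A\<close>, which is the
  degree-zero part \<open>A\<^sub>0\<close> (the image of the constants).
\<close>

definition has_dim :: "nat \<Rightarrow> 'k::field_char_0 mpoly set \<Rightarrow> nat \<Rightarrow> 'k mpoly set set \<Rightarrow> bool" where
  "has_dim r I n E \<longleftrightarrow> ring.dimension (quot_alg r I) n (quot_part r I 0) E"

definition artinian :: "('a, 'b) ring_scheme \<Rightarrow> bool" where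
  "artinian A \<longleftrightarrow>
     (\<forall>J :: nat \<Rightarrow> 'a set. (\<forall>n. ideal (J n) A \<and> J (Suc n) \<subseteq> J n) \<longrightarrow> (\<exists>N. \<forall>n\<ge>N. J n = J N))"

definition graded_artinian :: "nat \<Rightarrow> 'k::field_char_0 mpoly set \<Rightarrow> bool" where
  "graded_artinian r I \<longleftrightarrow>
     homogeneous_ideal r I \<and> I \<inter> forms r 1 = {0} \<and> artinian (quot_alg r I)"

text \<open>The list \<open>[h\<^sub>0,\<dots>,h\<^sub>e]\<close> is the \<open>h\<close>-vector of \<open>R/I\<close>, with \<open>e\<close> the last degree in which \<open>R/I\<close>
  is nonzero.\<close>

definition has_h_vector :: "nat \<Rightarrow> 'k::field_char_0 mpoly set \<Rightarrow> nat list \<Rightarrow> bool" where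
  "has_h_vector r I h \<longleftrightarrow>
     h \<noteq> [] \<and> last h > 0 \<and>
     (\<forall>i < length h. has_dim r I (h ! i) (quot_part r I i)) \<and>
     (\<forall>i \<ge> length h. has_dim r I 0 (quot_part r I i))"

abbreviation socle_degree :: "nat list \<Rightarrow> nat" where
  "socle_degree h \<equiv> length h - 1"

definition max_ideal :: "nat \<Rightarrow> 'k::field_char_0 mpoly set \<Rightarrow> 'k mpoly set set" where
  "max_ideal r I = Idl\<^bsub>quot_alg r I\<^esub> (\<Union>d\<in>{1..}. quot_part r I d)"

definition socle :: "nat \<Rightarrow> 'k::field_char_0 mpoly set \<Rightarrow> 'k mpoly set set" where
  "socle r I = {a \<in> carrier (quot_alg r I).
     \<forall>x \<in> max_ideal r I. a \<otimes>\<^bsub>quot_alg r I\<^esub> x = \<zero>\<^bsub>quot_alg r I\<^esub>}"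

definition level :: "nat \<Rightarrow> 'k::field_char_0 mpoly set \<Rightarrow> nat \<Rightarrow> nat \<Rightarrow> bool" where
  "level r I e t \<longleftrightarrow> socle r I \<subseteq> quot_part r I e \<and> has_dim r I t (socle r I)"

definition gorenstein_h_vector :: "'k::field_char_0 itself \<Rightarrow> nat list \<Rightarrow> bool" where
  "gorenstein_h_vector _ h \<longleftrightarrow>
     (\<exists>r (I :: 'k mpoly set).
        graded_artinian r I \<and> has_h_vector r I h \<and> level r I (socle_degree h) 1)"


section \<open>Macaulay's growth condition and SI-sequences\<close>

text \<open>
  The \<open>i\<close>-binomial expansion
  \<open>a = (n\<^sub>i choose i) + (n\<^sub>i\<^sub>-\<^sub>1 choose i-1) + \<dots> + (n\<^sub>j choose j)\<close>
  with \<open>n\<^sub>i > n\<^sub>i\<^sub>-\<^sub>1 > \<dots> > n\<^sub>j \<ge> j \<ge> 1\<close>, which exists and is unique for \<open>a, i \<ge> 1\<close>.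
\<close>

definition binomial_expansion :: "nat \<Rightarrow> nat \<Rightarrow> nat \<Rightarrow> (nat \<Rightarrow> nat) \<Rightarrow> bool" where
  "binomial_expansion i a j n \<longleftrightarrow>
     1 \<le> j \<and> j \<le> i \<and> j \<le> n j \<and> (\<forall>s\<in>{j..<i}. n s < n (Suc s)) \<and>
     a = (\<Sum>s=j..i. n s choose s)"

text \<open>The bound \<open>a\<^sup><\<^sup>i\<^sup>>\<close> in Macaulay's theorem, with the convention \<open>0\<^sup><\<^sup>i\<^sup>> = 0\<close>.\<close>

definition macaulay_bound :: "nat \<Rightarrow> nat \<Rightarrow> nat" where
  "macaulay_bound i a =
     (if a = 0 then 0
      else THE b. \<exists>j n. binomial_expansion i a j n \<and> b = (\<Sum>s=j..i. (n s + 1) choose (s + 1)))"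

lemma binomial_expansion_less:
  assumes "binomial_expansion i a j n"
  shows "a < (n i + 1) choose i \<and> i \<le> n i"
proof -
  have "1 \<le> j" "j \<le> i" using assms by (auto simp: binomial_expansion_def)
  have "(\<Sum>s=j..i. n s choose s) < (n i + 1) choose i \<and> i \<le> n i"
    if "j \<le> i" "\<forall>s\<in>{j..<i}. n s < n (Suc s)" for i
    using that
  proof (induction i rule: dec_induct)
    case base
    then obtain k where "j = Suc k" using \<open>1 \<le> j\<close> by (cases j) auto
    then show ?case using assms by (auto simp: binomial_expansion_def)
  next
    case (step i)
    then have IH: "(\<Sum>s=j..i. n s choose s) < (n i + 1) choose i" "i \<le> n i" and "n i < n (Suc i)"
      by auto
    then have "(n i + 1) choose i \<le> n (Suc i) choose i" by (intro binomial_right_mono) auto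
    moreover have "Suc i \<le> n (Suc i)" using IH(2) \<open>n i < n (Suc i)\<close> by linarith
    ultimately show ?case using IH(1) step by (simp add: sum.nat_ivl_Suc')
  qed
  with assms show ?thesis by (auto simp: binomial_expansion_def)
qed

lemma binomial_expansion_split:
  assumes "binomial_expansion i a j n" "j < i"
  shows "binomial_expansion (i - 1) (a - (n i choose i)) j n" "a - (n i choose i) > 0"
    "n i choose i \<le> a"
proof -
  obtain k where i: "i = Suc k" using assms(2) by (cases i) auto
  show exp: "binomial_expansion (i - 1) (a - (n i choose i)) j n" and "n i choose i \<le> a"
    using assms by (auto simp: binomial_expansion_def i sum.nat_ivl_Suc')
  from assms have "j \<le> n j" "j \<le> k" by (auto simp: binomial_expansion_def i)
  then have "0 < (\<Sum>s=j..k. n s choose s)"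
    by (intro sum_pos2[of _ j]) (auto simp: zero_less_binomial)
  with exp show "a - (n i choose i) > 0" by (auto simp: binomial_expansion_def i)
qed

lemma binomial_expansion_unique:
  assumes "binomial_expansion i a j n" "binomial_expansion i a j' n'"
  shows "j = j' \<and> (\<forall>s\<in>{j..i}. n s = n' s)"
  using assms
proof (induction i arbitrary: a)
  case 0
  then show ?case by (auto simp: binomial_expansion_def)
next
  case (Suc i)
  let ?i = "Suc i"
  have le: "n ?i choose ?i \<le> a" "n' ?i choose ?i \<le> a"
    using Suc.prems by (auto simp: binomial_expansion_def sum.nat_ivl_Suc')
  have less: "a < (n ?i + 1) choose ?i" "a < (n' ?i + 1) choose ?i"
    using Suc.prems binomial_expansion_less by blast+
  have "\<not> n ?i < n' ?i"
    using le less binomial_right_mono[of "n ?i + 1" "n' ?i" ?i] by fastforce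
  moreover have "\<not> n' ?i < n ?i"
    using le less binomial_right_mono[of "n' ?i + 1" "n ?i" ?i] by fastforce
  ultimately have top: "n ?i = n' ?i" by simp
  have single: "a = m ?i choose ?i" if "binomial_expansion ?i a ?i m" for m
    using that by (auto simp: binomial_expansion_def)
  have lt: "l < ?i \<or> l = ?i" if "binomial_expansion ?i a l m" for l m
    using that by (auto simp: binomial_expansion_def)
  consider "j = ?i" "j' = ?i" | "j = ?i" "j' < ?i" | "j < ?i" "j' = ?i" | "j < ?i" "j' < ?i"
    using lt Suc.prems by blast
  then show ?case
  proof cases
    case 1
    then show ?thesis using top by auto
  next
    case 2
    then show ?thesis using binomial_expansion_split(2)[OF Suc.prems(2)] single[of n] Suc.prems(1) top
      by auto
  next
    case 3
    then show ?thesis using binomial_expansion_split(2)[OF Suc.prems(1)] single[of n'] Suc.prems(2) top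
      by auto
  next
    case 4
    have "j = j' \<and> (\<forall>s\<in>{j..i}. n s = n' s)"
      using binomial_expansion_split(1)[OF Suc.prems(1)] binomial_expansion_split(1)[OF Suc.prems(2)]
        4 top by (intro Suc.IH[of "a - (n ?i choose ?i)"]) auto
    then show ?thesis using top by (auto simp: le_Suc_eq)
  qed
qed

lemma binomial_expansion_exists:
  assumes "i \<ge> 1" "a > 0"
  shows "\<exists>j n. binomial_expansion i a j n"
  using assms
proof (induction i arbitrary: a rule: nat_induct_at_least)
  case base
  have "binomial_expansion 1 a 1 (\<lambda>_. a)" using base by (auto simp: binomial_expansion_def)
  then show ?case by blast
next
  case (Suc i)
  let ?i = "Suc i"
  have bnd: "\<forall>N. N choose ?i \<le> a \<longrightarrow> N \<le> a + ?i"
  proof (intro allI impI, rule ccontr)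
    fix N assume N: "N choose ?i \<le> a" "\<not> N \<le> a + ?i"
    have "Suc (a + i) choose ?i \<le> N choose ?i" using N(2) by (intro binomial_right_mono) auto
    moreover have "a < Suc (a + i) choose ?i" for a
    proof (induction a)
      case (Suc b)
      have "0 < Suc (b + i) choose i" by (intro zero_less_binomial) auto
      moreover have "Suc (Suc b + i) choose ?i = (Suc (b + i) choose i) + (Suc (b + i) choose ?i)"
        by (metis add_Suc binomial_Suc_Suc)
      ultimately show ?case using Suc by linarith
    qed simp
    ultimately show False using N(1) by (meson le_trans not_less)
  qed
  define N where "N = (GREATEST N. N choose ?i \<le> a)"
  have "?i choose ?i \<le> a" using Suc.prems by simp
  then have N: "N choose ?i \<le> a" "?i \<le> N" and nN: "\<not> (Suc N choose ?i \<le> a)"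
    unfolding N_def
    using GreatestI_nat[of "\<lambda>N. N choose ?i \<le> a" ?i] Greatest_le_nat[of "\<lambda>N. N choose ?i \<le> a" _ "a + ?i"] bnd
    by (metis, metis, metis not_less_eq_eq order_refl)
  define c where "c = a - (N choose ?i)"
  have c: "c < N choose i" "a = c + (N choose ?i)" using N nN by (auto simp: c_def)
  show ?case
  proof (cases "c = 0")
    case True
    then have "binomial_expansion ?i a ?i (\<lambda>_. N)" using c N by (auto simp: binomial_expansion_def)
    then show ?thesis by blast
  next
    case False
    then obtain j n where e: "binomial_expansion i c j n" using Suc.IH[of c] by auto
    have "n i < N"
    proof (rule ccontr)
      assume "\<not> n i < N"
      then have "N choose i \<le> n i choose i" by (intro binomial_right_mono) auto
      moreover have "n i choose i \<le> c"
        using e member_le_sum[of i "{j..i}" "\<lambda>s. n s choose s"] by (auto simp: binomial_expansion_def)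
      ultimately show False using c by simp
    qed
    have s: "(\<Sum>s=j..i. (n(?i := N)) s choose s) = (\<Sum>s=j..i. n s choose s)"
      by (intro sum.cong) auto
    have "binomial_expansion ?i a j (n(?i := N))"
      using e \<open>n i < N\<close> c s
      by (auto simp: binomial_expansion_def sum.nat_ivl_Suc' less_Suc_eq)
    then show ?thesis by blast
  qed
qed

lemma macaulay_bound_eq:
  assumes "binomial_expansion i a j n" "a > 0"
  shows "macaulay_bound i a = (\<Sum>s=j..i. (n s + 1) choose (s + 1))"
proof -
  have "b = (\<Sum>s=j..i. (n s + 1) choose (s + 1))"
    if "\<exists>j n. binomial_expansion i a j n \<and> b = (\<Sum>s=j..i. (n s + 1) choose (s + 1))" for b
  proof -
    from that obtain j' n' where b: "binomial_expansion i a j' n'"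
      "b = (\<Sum>s=j'..i. (n' s + 1) choose (s + 1))" by blast
    with binomial_expansion_unique[OF assms(1) b(1)] show ?thesis by (auto intro!: sum.cong)
  qed
  then show ?thesis using assms unfolding macaulay_bound_def by (auto intro!: the_equality)
qed

definition macaulay :: "int list \<Rightarrow> bool" where
  "macaulay d \<longleftrightarrow>
     d \<noteq> [] \<and> d ! 0 = 1 \<and> (\<forall>i < length d. d ! i \<ge> 0) \<and>
     (\<forall>i. 1 \<le> i \<and> i + 1 < length d \<longrightarrow> d ! (i + 1) \<le> int (macaulay_bound i (nat (d ! i))))"

definition first_half_difference :: "nat list \<Rightarrow> int list" where
  "first_half_difference h =
     1 # map (\<lambda>i. int (h ! i) - int (h ! (i - 1))) [1..<socle_degree h div 2 + 1]"

definition SI_sequence :: "nat list \<Rightarrow> bool" where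
  "SI_sequence h \<longleftrightarrow>
     h \<noteq> [] \<and> h ! 0 = 1 \<and>
     (\<forall>i \<le> socle_degree h. h ! i = h ! (socle_degree h - i)) \<and>
     macaulay (first_half_difference h)"


section \<open>The interval conjectures\<close>

definition IC :: "nat list set \<Rightarrow> bool" where
  "IC C \<longleftrightarrow>
     (\<forall>h i \<alpha>. i < length h \<and> \<alpha> > 0 \<and> h \<in> C \<and> h[i := h ! i + \<alpha>] \<in> C \<longrightarrow>
        (\<forall>\<beta> \<le> \<alpha>. h[i := h ! i + \<beta>] \<in> C))"

text \<open>For \<open>i = e - i\<close> the two updates below coincide, so the middle entry is raised only once.\<close>

definition raise_pair :: "nat list \<Rightarrow> nat \<Rightarrow> nat \<Rightarrow> nat list" where
  "raise_pair h i \<alpha> =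
     (let e = socle_degree h in h[i := h ! i + \<alpha>, e - i := h ! (e - i) + \<alpha>])"

definition GIC :: "nat list set \<Rightarrow> bool" where
  "GIC C \<longleftrightarrow>
     (\<forall>h i \<alpha>. i < length h \<and> \<alpha> > 0 \<and> h \<in> C \<and> raise_pair h i \<alpha> \<in> C \<longrightarrow>
        (\<forall>\<beta> \<le> \<alpha>. raise_pair h i \<beta> \<in> C))"

end

theory Submission
  imports Defs
begin

text \<open>
  Write \<open>d\<^sub>k = h\<^sub>k - h\<^sub>k\<^sub>-\<^sub>1\<close> on the first half of \<open>h\<close>. Raising \<open>h\<^sub>i\<close> by \<open>\<beta>\<close> raises \<open>d\<^sub>i\<close> by \<open>\<beta>\<close>, lowers
  \<open>d\<^sub>i\<^sub>+\<^sub>1\<close> by \<open>\<beta>\<close>, and leaves the other differences alone. As \<open>a\<^sup><\<^sup>k\<^sup>>\<close> is nondecreasing in \<open>a\<close>, each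
  condition on the differences is monotone in \<open>\<beta>\<close>, one way or the other, so it holds for
  \<open>0 \<le> \<beta> \<le> \<alpha>\<close> once it holds at both ends. A change in a single degree can keep
  \<open>h\<close> symmetric only in the middle degree, so the IC is a special case of the GIC.
\<close>

lemma macaulay_bound_0 [simp]: "macaulay_bound i 0 = 0"
  by (simp add: macaulay_bound_def)

text \<open>The bound \<open>a\<^sup><\<^sup>i\<^sup>>\<close> comes with its own \<open>(i + 1)\<close>-binomial expansion, hence obeys the same top-term
  estimates as \<open>a\<close>.\<close>

lemma binomial_expansion_macaulay_bound:
  assumes "binomial_expansion i a j n" "a > 0"
  shows "binomial_expansion (Suc i) (macaulay_bound i a) (Suc j) (\<lambda>s. n (s - 1) + 1)"
proof -
  have "macaulay_bound i a = (\<Sum>s=Suc j..Suc i. (n (s - 1) + 1) choose s)"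
    unfolding macaulay_bound_eq[OF assms] sum.shift_bounds_cl_Suc_ivl by simp
  moreover have "n (s - Suc 0) < n s" if "Suc j \<le> s" "s < Suc i" for s
  proof -
    have "s - 1 \<in> {j..<i}" "Suc (s - 1) = s" using that by auto
    then show ?thesis using assms(1) by (metis One_nat_def binomial_expansion_def)
  qed
  ultimately show ?thesis
    using assms(1) by (auto simp: binomial_expansion_def)
qed

text \<open>Peels off the top binomial so that monotonicity can be proved by induction on
  \<open>i\<close>. A one-term expansion leaves remainder 0, where the convention
  \<open>macaulay_bound_0\<close> applies.\<close>

lemma macaulay_bound_split:
  assumes "binomial_expansion i a j n" "a > 0"
  shows "macaulay_bound i a
    = ((n i + 1) choose (i + 1)) + macaulay_bound (i - 1) (a - (n i choose i))"
proof (cases "j < i")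
  case True
  then obtain k where "i = Suc k" by (cases i) auto
  with True show ?thesis
    using macaulay_bound_eq[OF assms]
      macaulay_bound_eq[OF binomial_expansion_split(1,2)[OF assms(1) True]]
    by (simp add: sum.nat_ivl_Suc')
next
  case False
  then have "j = i" "a = n i choose i" using assms(1) by (auto simp: binomial_expansion_def)
  then show ?thesis using macaulay_bound_eq[OF assms] by simp
qed

lemma binomial_expansion_top_le:
  assumes "binomial_expansion i a j n"
  shows "n i choose i \<le> a"
  using assms member_le_sum[of i "{j..i}" "\<lambda>s. n s choose s"] by (auto simp: binomial_expansion_def)

text \<open>Numbers are ordered lexicographically by their expansions, top entry first, and the
  bounds inherit this order: equal top entries reduce to the remainders in degree
  \<open>i - 1\<close>, and different ones already decide the comparison.\<close>

lemma macaulay_bound_mono: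
  assumes "i \<ge> 1" "a \<le> b"
  shows "macaulay_bound i a \<le> macaulay_bound i b"
  using assms
proof (induction i arbitrary: a b rule: nat_induct_at_least)
  case base
  have "macaulay_bound 1 c = (c + 1) choose 2" if "c > 0" for c
    using macaulay_bound_eq[of 1 c 1 "\<lambda>_. c"] that
    by (simp add: binomial_expansion_def numeral_2_eq_2)
  then show ?case using base
    by (cases "a = 0") (auto intro: binomial_right_mono)
next
  case (Suc i)
  show ?case
  proof (cases "a = 0")
    case False
    then have pos: "a > 0" "b > 0" using Suc.prems by auto
    obtain j n where a: "binomial_expansion (Suc i) a j n"
      using binomial_expansion_exists pos by (metis le_add1 plus_1_eq_Suc)
    obtain j' n' where b: "binomial_expansion (Suc i) b j' n'"
      using binomial_expansion_exists pos by (metis le_add1 plus_1_eq_Suc)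
    note split = macaulay_bound_split[OF a pos(1)] macaulay_bound_split[OF b pos(2)]
    \<comment> \<open>Otherwise \<open>b\<close> would lie below the top term of \<open>a\<close>,
      hence below \<open>a\<close>.\<close>
    have "\<not> n' (Suc i) < n (Suc i)"
      using binomial_expansion_less[OF b] binomial_expansion_top_le[OF a] Suc.prems
        binomial_right_mono[of "n' (Suc i) + 1" "n (Suc i)" "Suc i"] by linarith
    then consider "n (Suc i) = n' (Suc i)" | "n (Suc i) < n' (Suc i)" by linarith
    then show ?thesis
    proof cases
      case 1
      then show ?thesis unfolding split
        using Suc.IH Suc.prems by (simp add: diff_le_mono)
    next
      case 2
      \<comment> \<open>The expansion of the bound has top entry \<open>n (Suc i) + 1\<close> in
        degree \<open>i + 2\<close>; the lower terms together cannot reach the next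
        binomial.\<close>
      have "macaulay_bound (Suc i) a < (n (Suc i) + 2) choose Suc (Suc i)"
        using binomial_expansion_less[OF binomial_expansion_macaulay_bound[OF a pos(1)]] by simp
      also have "\<dots> \<le> (n' (Suc i) + 1) choose Suc (Suc i)"
        using 2 by (intro binomial_right_mono) auto
      also have "\<dots> \<le> macaulay_bound (Suc i) b" unfolding split by simp
      finally show ?thesis by simp
    qed
  qed simp
qed

lemma SI_sequence_iff:
  assumes "length h = Suc e"
  shows "SI_sequence h \<longleftrightarrow> h ! 0 = 1 \<and> (\<forall>k\<le>e. h ! k = h ! (e - k)) \<and>
    (\<forall>k. 1 \<le> k \<and> k \<le> e div 2 \<longrightarrow> h ! (k - 1) \<le> h ! k) \<and>
    (\<forall>k. 1 \<le> k \<and> k + 1 \<le> e div 2 \<longrightarrow>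
      h ! (k + 1) \<le> h ! k + macaulay_bound k (h ! k - h ! (k - 1)))"
proof -
  let ?d = "first_half_difference h"
  have len: "length ?d = Suc (e div 2)" and d0: "?d ! 0 = 1"
    using assms by (auto simp: first_half_difference_def)
  have d: "?d ! k = int (h ! k) - int (h ! (k - 1))" if "1 \<le> k" "k \<le> e div 2" for k
    using that assms by (auto simp: first_half_difference_def nth_Cons' simp del: upt_Suc)
  have nonneg: "(\<forall>k < length ?d. ?d ! k \<ge> 0) \<longleftrightarrow>
      (\<forall>k. 1 \<le> k \<and> k \<le> e div 2 \<longrightarrow> h ! (k - 1) \<le> h ! k)" (is "?L \<longleftrightarrow> ?R")
  proof -
    have "?d ! k \<ge> 0 \<longleftrightarrow> h ! (k - 1) \<le> h ! k" if "1 \<le> k" "k \<le> e div 2" for k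
      using d[OF that] by simp
    moreover have "k < length ?d \<longleftrightarrow> k = 0 \<or> 1 \<le> k \<and> k \<le> e div 2" for k by (auto simp: len)
    ultimately show ?thesis using d0 by (metis zero_le_one)
  qed
  \<comment> \<open>\<open>nat\<close> of an integer difference and subtraction of naturals both cut
    off at 0, so the two sides agree even where \<open>h\<close> decreases.\<close>
  have growth: "?d ! (k + 1) \<le> int (macaulay_bound k (nat (?d ! k))) \<longleftrightarrow>
      h ! (k + 1) \<le> h ! k + macaulay_bound k (h ! k - h ! (k - 1))"
    if "1 \<le> k" "k + 1 \<le> e div 2" for k
    using d[of k] d[of "k + 1"] that by (auto simp: nat_diff_distrib' simp flip: of_nat_add)
  have "macaulay ?d \<longleftrightarrow>
    (\<forall>k. 1 \<le> k \<and> k \<le> e div 2 \<longrightarrow> h ! (k - 1) \<le> h ! k) \<and>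
    (\<forall>k. 1 \<le> k \<and> k + 1 \<le> e div 2 \<longrightarrow>
      h ! (k + 1) \<le> h ! k + macaulay_bound k (h ! k - h ! (k - 1)))"
    unfolding macaulay_def nonneg using growth len d0 by (auto simp: less_Suc_eq_le)
  moreover have "h \<noteq> []" "length h - 1 = e" using assms by auto
  ultimately show ?thesis unfolding SI_sequence_def by simp
qed

lemma length_raise_pair [simp]: "length (raise_pair h i \<alpha>) = length h"
  by (simp add: raise_pair_def Let_def)

lemma nth_raise_pair:
  assumes "length h = Suc e" "k \<le> e"
  shows "raise_pair h i \<alpha> ! k = h ! k + (if k = i \<or> k = e - i then \<alpha> else 0)"
  using assms by (auto simp: raise_pair_def Let_def nth_list_update)

lemma raise_pair_reflect:
  assumes "length h = Suc e" "i \<le> e"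
  shows "raise_pair h (e - i) \<alpha> = raise_pair h i \<alpha>"
  using assms by (intro nth_equalityI) (auto simp: nth_raise_pair)

lemma SI_sequence_raise_pair_interval:
  assumes len: "length h = Suc e" and i: "2 \<le> i" "i \<le> e div 2" and \<beta>: "\<beta> \<le> \<alpha>"
    and h: "SI_sequence h" and h\<alpha>: "SI_sequence (raise_pair h i \<alpha>)"
  shows "SI_sequence (raise_pair h i \<beta>)"
proof -
  \<comment> \<open>The mirror index \<open>e - i\<close> lies beyond the first half unless it
    equals \<open>i\<close>, so only one entry moves here.\<close>
  have first: "raise_pair h i \<gamma> ! k = h ! k + (if k = i then \<gamma> else 0)" if "k \<le> e div 2" for k \<gamma>
    using that i by (auto simp: nth_raise_pair[OF len])
  note h = h[unfolded SI_sequence_iff[OF len]]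
  have len': "length (raise_pair h i \<gamma>) = Suc e" for \<gamma> using len by simp
  note h\<alpha> = h\<alpha>[unfolded SI_sequence_iff[OF len']]
  have "h ! 0 = 1" using h by blast
  then have "raise_pair h i \<beta> ! 0 = 1" using i first by simp
  moreover have "raise_pair h i \<beta> ! k = raise_pair h i \<beta> ! (e - k)" if "k \<le> e" for k
  proof -
    have "k = i \<or> k = e - i \<longleftrightarrow> e - k = i \<or> e - k = e - i"
      using that i by auto
    moreover have "h ! k = h ! (e - k)" using h that by blast
    ultimately show ?thesis using that by (simp add: nth_raise_pair[OF len])
  qed
  moreover have "raise_pair h i \<beta> ! (k - 1) \<le> raise_pair h i \<beta> ! k"
    if k: "1 \<le> k" "k \<le> e div 2" for k
  proof -
    have "h ! (k - 1) \<le> h ! k" using h k by blast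
    moreover have "raise_pair h i \<alpha> ! (k - 1) \<le> raise_pair h i \<alpha> ! k" using h\<alpha> k by blast
    ultimately show ?thesis using k \<beta> by (auto simp: first split: if_splits)
  qed
  moreover have "raise_pair h i \<beta> ! (k + 1) \<le> raise_pair h i \<beta> ! k
      + macaulay_bound k (raise_pair h i \<beta> ! k - raise_pair h i \<beta> ! (k - 1))"
    if k: "1 \<le> k" "k + 1 \<le> e div 2" for k
  proof -
    have lower: "h ! (k + 1) \<le> h ! k + macaulay_bound k (h ! k - h ! (k - 1))"
      using h k by blast
    have upper: "raise_pair h i \<alpha> ! (k + 1) \<le> raise_pair h i \<alpha> ! k
        + macaulay_bound k (raise_pair h i \<alpha> ! k - raise_pair h i \<alpha> ! (k - 1))"
      using h\<alpha> k by blast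
    \<comment> \<open>For \<open>k + 1 = i\<close> the left side grows with \<beta>, and for
      \<open>k = i + 1\<close> the right side shrinks, so \<alpha> is the worst case. For
      \<open>k = i\<close> the right side grows, so \<open>h\<close> itself is the worst
      case.\<close>
    consider "k + 1 = i" | "k = i" | "k = i + 1" | "k + 1 \<noteq> i" "k \<noteq> i" "k \<noteq> i + 1" by blast
    then show ?thesis
    proof cases
      case 1
      then show ?thesis using upper k \<beta> by (auto simp: first)
    next
      case 2
      have "macaulay_bound k (h ! k - h ! (k - 1)) \<le> macaulay_bound k (h ! k + \<beta> - h ! (k - 1))"
        using k by (intro macaulay_bound_mono) auto
      then show ?thesis using 2 lower k by (auto simp: first)
    next
      case 3
      have "macaulay_bound k (h ! k - (h ! i + \<alpha>)) \<le> macaulay_bound k (h ! k - (h ! i + \<beta>))"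
        using k \<beta> by (intro macaulay_bound_mono) auto
      then show ?thesis using 3 upper k by (simp add: first)
    next
      case 4
      then have "k - 1 \<noteq> i" using k by auto
      with 4 show ?thesis using lower k by (simp add: first)
    qed
  qed
  ultimately show ?thesis unfolding SI_sequence_iff[OF len'] by blast
qed

lemma GIC_SI_sequences:
  assumes "e > 0"
  shows "GIC {h. SI_sequence h \<and> socle_degree h = e \<and> h ! 1 = r}"
  unfolding GIC_def
proof (intro allI impI, elim conjE)
  let ?C = "{h. SI_sequence h \<and> socle_degree h = e \<and> h ! 1 = r}"
  fix h :: "nat list" and i \<alpha> \<beta> :: nat
  assume i: "i < length h" and \<alpha>: "\<alpha> > 0" and h: "h \<in> ?C" "raise_pair h i \<alpha> \<in> ?C" and \<beta>: "\<beta> \<le> \<alpha>"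
  have len: "length h = Suc e" using h(1) assms by auto
  have low: "raise_pair h j \<beta> \<in> ?C" if j: "j \<le> e div 2" and hj: "raise_pair h j \<alpha> \<in> ?C" for j
  proof -
    have len': "length (raise_pair h j \<gamma>) = Suc e" for \<gamma> using len by simp
    have "h ! 0 = 1" "h ! 1 = r" using h(1) by (auto simp: SI_sequence_def)
    moreover have "raise_pair h j \<alpha> ! 0 = 1" "raise_pair h j \<alpha> ! 1 = r"
      using hj by (auto simp: SI_sequence_def)
    \<comment> \<open>Membership in the class pins entry 0 to 1 and entry 1 to \<open>r\<close>, so
      a positive raise cannot touch either.\<close>
    ultimately have "j \<noteq> 0" "j \<noteq> 1" and ne: "1 \<noteq> e - j"
      using \<alpha> assms nth_raise_pair[OF len, of 0 j \<alpha>] nth_raise_pair[OF len, of 1 j \<alpha>]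
      by (auto split: if_splits)
    then have "2 \<le> j" by simp
    then have "SI_sequence (raise_pair h j \<beta>)"
      using SI_sequence_raise_pair_interval[OF len] j \<beta> h(1) hj by blast
    moreover have "raise_pair h j \<beta> ! 1 = r"
      using \<open>j \<noteq> 1\<close> ne \<open>h ! 1 = r\<close> assms nth_raise_pair[OF len, of 1 j \<beta>] by auto
    ultimately show ?thesis using len by simp
  qed
  show "raise_pair h i \<beta> \<in> ?C"
  proof (cases "i \<le> e div 2")
    case True
    then show ?thesis using low h(2) by blast
  next
    case False
    then have "e - i \<le> e div 2" "i \<le> e" using i len by auto
    then show ?thesis using low[of "e - i"] h(2) raise_pair_reflect[OF len] by simp
  qed
qed

lemma IC_if_GIC:
  assumes "GIC C" and sym: "\<And>h i. h \<in> C \<Longrightarrow> i < length h \<Longrightarrow> h ! i = h ! (socle_degree h - i)"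
  shows "IC C"
  unfolding IC_def
proof (intro allI impI, elim conjE)
  fix h i \<alpha> \<beta>
  assume i: "i < length h" and \<alpha>: "\<alpha> > 0" and h: "h \<in> C" "h[i := h ! i + \<alpha>] \<in> C" and \<beta>: "\<beta> \<le> \<alpha>"
  have mid: "socle_degree h - i = i"
  proof (rule ccontr)
    assume "socle_degree h - i \<noteq> i"
    \<comment> \<open>The entry in degree \<open>e - i\<close> is unchanged, yet symmetry before and
      after the raise equates it with both \<open>h ! i\<close> and
      \<open>h ! i + \<alpha>\<close>.\<close>
    then show False using sym[OF h(1) i] sym[OF h(2), of i] i \<alpha> by simp
  qed
  then have "raise_pair h i \<gamma> = h[i := h ! i + \<gamma>]" for \<gamma>
    by (simp add: raise_pair_def Let_def)
  then show "h[i := h ! i + \<beta>] \<in> C"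
    using assms(1) i \<alpha> h \<beta> unfolding GIC_def by metis
qed

theorem proposition2p1:
  fixes e r :: nat and C :: "nat list set"
  assumes "e > 0" and "r > 0"
    and "C = {h. gorenstein_h_vector TYPE('k::field_char_0) h \<and> socle_degree h = e \<and> h ! 1 = r}"
    and "C = {h. SI_sequence h \<and> socle_degree h = e \<and> h ! 1 = r}"
  shows "GIC C \<and> IC C"
proof
  show "GIC C" unfolding assms(4) using assms(1) by (rule GIC_SI_sequences)
  then show "IC C"
  proof (rule IC_if_GIC)
    fix h i
    assume "h \<in> C" "i < length h"
    then have "SI_sequence h" "i \<le> socle_degree h" by (auto simp: assms(4))
    then show "h ! i = h ! (socle_degree h - i)" unfolding SI_sequence_def by blast
  qed
qed

end
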